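(* Let $D=(V,E)$ be a digraph and $e\in E$. Then \[ \widehat{\sigma\pi}(D)= \begin{cases} \widehat{\sigma\pi}(D_{-e})+xy\,\widehat{\sigma\pi}(D_{/e}) & \text{if } e \text{ is a loop},\\ \widehat{\sigma\pi}(D_{-e})+x\,\widehat{\sigma\pi}(D_{/e})+x(z-1)\,\widehat{\sigma\pi}(D_{\dagger e}) & \text{otherwise}. \end{cases} \] Moreover, $\widehat{\sigma\pi}(E_n)=1$ for every $n\ge0$, where $E_n$ is the arcless digraph on $n$ vertices.
   Context: Digraphs are finite directed multigraphs; loops and multiple arcs are allowed. For $F\subseteq E$, $D\langle F\rangle=(V,F)$. $kc(H)$ is the number of components of $H$ that are directed cycles (including loops). $kp(H)$ is the number of components of $H$ that are directed paths with at least one arc. The trivariate cycle-path polynomial is \[ \widehat{\sigma\pi}(D;x,y,z)=\sum_F x^{|F|}y^{kc(D\langle F\rangle)}z^{kp(D\langle F\rangle)}, \] summed over all $F\subseteq E$ in which every vertex has in-degree at most 1 and out-degree at most 1 in $D\langle F\rangle$. The arc operations are as follows. $D_{-e}$ deletes $e$. If $e=(u,v)$ with $u\ne v$, then $D_{/e}$ removes all arcs with tail $u$ and all arcs with head $v$ (including $e$), and then identifies $u$ and $v$ into one new vertex. If $e=(u,u)$ is a loop, then $D_{/e}$ deletes $u$ and its incident arcs. For $e=(u,v)$, $D_{\dagger e}$ deletes $u$, $v$ and all arcs incident to them. *)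

theory Defs
  imports "Graph_Theory.Digraph_Component"
begin

text \<open>
  Digraphs are those of \<^locale>\<open>fin_digraph\<close>: finite, with loops and parallel arcs allowed, and
  possibly without vertices.
\<close>

definition span_sub :: "('a, 'b) pre_digraph \<Rightarrow> 'b set \<Rightarrow> ('a, 'b) pre_digraph" where
  "span_sub D F = D\<lparr>arcs := F\<rparr>"

text \<open>
  \<^const>\<open>connected\<close> is connectedness of the underlying undirected graph, so these are the weak
  components. A subgraph shares the tail and head functions of the whole digraph, hence
  distinct members of this set are distinct components.
\<close>

definition components :: "('a, 'b) pre_digraph \<Rightarrow> ('a, 'b) pre_digraph set" where
  "components H = {C. pre_digraph.max_subgraph H connected C}"

text \<open>
  In the next two definitions the whole digraph is a directed cycle or path: the walk uses all
  its arcs and vertices. \<^const>\<open>pre_digraph.cycle\<close> admits loops (cycles of length 1).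
\<close>

definition is_dicycle :: "('a, 'b) pre_digraph \<Rightarrow> bool" where
  "is_dicycle C \<longleftrightarrow>
    (\<exists>p. pre_digraph.cycle C p \<and> arcs C = set p \<and> verts C = head C ` set p)"

definition is_nontrivial_dipath :: "('a, 'b) pre_digraph \<Rightarrow> bool" where
  "is_nontrivial_dipath C \<longleftrightarrow>
    (\<exists>u p v. pre_digraph.apath C u p v \<and> p \<noteq> [] \<and> arcs C = set p \<and>
       verts C = set (pre_digraph.awalk_verts C u p))"

definition kc :: "('a, 'b) pre_digraph \<Rightarrow> nat" where
  "kc H = card {C \<in> components H. is_dicycle C}"

definition kp :: "('a, 'b) pre_digraph \<Rightarrow> nat" where
  "kp H = card {C \<in> components H. is_nontrivial_dipath C}"

definition cycle_path_sets :: "('a, 'b) pre_digraph \<Rightarrow> 'b set set" where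
  "cycle_path_sets D = {F. F \<subseteq> arcs D \<and>
     (\<forall>v \<in> verts D. in_degree (span_sub D F) v \<le> 1 \<and> out_degree (span_sub D F) v \<le> 1)}"

text \<open>
  The indeterminates range over an arbitrary commutative ring. Taking them to be the three
  indeterminates of the iterated polynomial ring over the integers gives the formal polynomial,
  so an identity valid in all commutative rings is an identity of polynomials.
\<close>

definition cycle_path_poly ::
  "('a, 'b) pre_digraph \<Rightarrow> 'r::comm_ring_1 \<Rightarrow> 'r \<Rightarrow> 'r \<Rightarrow> 'r" where
  "cycle_path_poly D x y z =
     (\<Sum>F \<in> cycle_path_sets D. x ^ card F * y ^ kc (span_sub D F) * z ^ kp (span_sub D F))"

text \<open>
  The vertex obtained by identifying the ends \<open>u\<close> and \<open>v\<close> of a non-loop \<open>e\<close> reuses the name \<open>u\<close>,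
  which keeps the vertex type unchanged.
\<close>

definition contract_arc :: "('a, 'b) pre_digraph \<Rightarrow> 'b \<Rightarrow> ('a, 'b) pre_digraph" where
  "contract_arc D e =
    (let u = tail D e; v = head D e; ident = (\<lambda>w. if w = v then u else w) in
     if u = v then pre_digraph.del_vert D u
     else \<lparr> verts = ident ` verts D,
            arcs = {a \<in> arcs D. tail D a \<noteq> u \<and> head D a \<noteq> v},
            tail = (\<lambda>a. ident (tail D a)),
            head = (\<lambda>a. ident (head D a)) \<rparr>)"

definition extract_arc :: "('a, 'b) pre_digraph \<Rightarrow> 'b \<Rightarrow> ('a, 'b) pre_digraph" where
  "extract_arc D e = pre_digraph.del_vert (pre_digraph.del_vert D (tail D e)) (head D e)"

definition arcless_digraph :: "nat \<Rightarrow> ('a, 'b) pre_digraph \<Rightarrow> bool" where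
  "arcless_digraph n D \<longleftrightarrow> fin_digraph D \<and> card (verts D) = n \<and> arcs D = {}"

end

theory Submission
  imports Defs
begin

text \<open>
  If all in- and out-degrees of \<open>(V, F)\<close> are at most 1, both statistics can be read off the tail and
  head maps alone. The cyclic components are the minimal nonempty arc sets \<open>S \<subseteq> F\<close> whose set of
  tails equals their set of heads, and the nontrivial path components correspond to their start
  vertices, which are the tails of \<open>F\<close> that are not heads of \<open>F\<close>.

  The sets \<open>F\<close> avoiding \<open>e\<close> give the deletion term. The sets containing \<open>e = (u, v)\<close> correspond to
  the admissible sets \<open>F - {e}\<close> of the contraction. For a loop this loses the cycle \<open>{e}\<close>. For
  \<open>u \<noteq> v\<close>, the map \<open>S \<mapsto> S - {e}\<close> is an order isomorphism between the sets with equal tails and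
  heads, so the cycles are preserved; the paths are preserved too, except that one is lost when the
  merged vertex becomes isolated, and the sets for which this happens are exactly the admissible
  sets of the extraction.
\<close>

section \<open>Components\<close>

text \<open>No arc of \<open>H\<close> leads from \<open>C\<close> to the outside. For connected
  subgraphs this local condition replaces maximality, which is awkward to check directly.\<close>

definition arc_closed :: "('a, 'b) pre_digraph \<Rightarrow> ('a, 'b) pre_digraph \<Rightarrow> bool" where
  "arc_closed H C \<longleftrightarrow>
    (\<forall>a \<in> arcs H. tail H a \<in> verts C \<or> head H a \<in> verts C \<longrightarrow> a \<in> arcs C)"

text \<open>Unfolds strong connectedness of the symmetrised digraph into a reflexive transitive
  closure, so that connectedness can be handled by induction along undirected walks.\<close>

lemma (in wf_digraph) connected_conv:
  "connected G \<longleftrightarrow> verts G \<noteq> {} \<and>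
    (\<forall>u \<in> verts G. \<forall>v \<in> verts G. (u, v) \<in> (arcs_ends G \<union> (arcs_ends G)\<inverse>)\<^sup>*)"
proof -
  interpret S: pair_wf_digraph "mk_symmetric G" ..
  have "arcs_ends (with_proj (mk_symmetric G)) = arcs_ends G \<union> (arcs_ends G)\<inverse>"
    by (auto simp: parcs_mk_symmetric arcs_ends_conv)
  then show ?thesis
    by (auto simp: connected_def strongly_connected_def S.reachable_conv)
qed

lemma (in wf_digraph) awalk_imp_connected:
  assumes "awalk u p v" "set p = arcs G" "set (awalk_verts u p) = verts G"
  shows "connected G"
proof -
  let ?R = "(arcs_ends G \<union> (arcs_ends G)\<inverse>)\<^sup>*"
  have "sym ?R" by (intro sym_rtrancl sym_Un_converse)
  have reach: "(u, w) \<in> ?R" if "w \<in> verts G" for w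
  proof -
    have "(u, w) \<in> (arcs_ends G)\<^sup>*"
      using awalk_verts_reachable_from[OF assms(1)] that assms(3) by (auto intro: reachable_rtranclI)
    then show ?thesis using rtrancl_mono[of "arcs_ends G"] by blast
  qed
  moreover have "(w, w') \<in> ?R" if "w \<in> verts G" "w' \<in> verts G" for w w'
    using reach[OF that(1)] reach[OF that(2)] \<open>sym ?R\<close> by (meson symE rtrancl_trans)
  moreover have "verts G \<noteq> {}" using assms(3) by auto
  ultimately show ?thesis by (auto simp: connected_conv)
qed

text \<open>An undirected walk in \<open>B\<close> that starts at the shared vertex \<open>x\<close>
  never leaves \<open>C\<close>: each arc it uses touches \<open>C\<close>, so the arc, and with it
  its other end, belongs to \<open>C\<close>.\<close>

lemma connected_subset_arc_closed:
  assumes "subgraph B H" "connected B" "arc_closed H C" "subgraph C H"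
    and x: "x \<in> verts B" "x \<in> verts C"
  shows "verts B \<subseteq> verts C" "arcs B \<subseteq> arcs C"
proof -
  interpret B: wf_digraph B using assms(1) by auto
  interpret C: wf_digraph C using assms(4) by auto
  have tl: "tail B = tail H" "head B = head H" "tail C = tail H" "head C = head H"
    and sub: "arcs B \<subseteq> arcs H"
    using assms(1,4) by (auto simp: subgraph_def compatible_def)
  have step: "z \<in> verts C"
    if yz: "(y, z) \<in> arcs_ends B \<union> (arcs_ends B)\<inverse>" "y \<in> verts C" for y z
  proof -
    obtain a where a: "a \<in> arcs B" "tail H a = y \<and> head H a = z \<or> tail H a = z \<and> head H a = y"
      using yz(1) unfolding arcs_ends_conv tl by blast
    then have "a \<in> arcs C" using assms(3) sub yz(2) unfolding arc_closed_def by auto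
    then show ?thesis using a(2) C.wellformed tl by auto
  qed
  have "y \<in> verts C" if "(x, y) \<in> (arcs_ends B \<union> (arcs_ends B)\<inverse>)\<^sup>*" for y
    using that by (induction rule: rtrancl_induct) (use x step in blast)+
  then show *: "verts B \<subseteq> verts C"
    using assms(2) x by (auto simp: B.connected_conv)
  show "arcs B \<subseteq> arcs C"
    using * assms(3) sub B.wellformed unfolding arc_closed_def tl by blast
qed

lemma subgraph_antisym_sets:
  assumes "subgraph B H" "subgraph C H" "verts B = verts C" "arcs B = arcs C"
  shows "B = C"
  using assms by (auto simp: subgraph_def compatible_def)

lemma arc_closed_in_components:
  assumes "subgraph C H" "connected C" "arc_closed H C"
  shows "C \<in> components H"
proof -
  have "B = C" if B: "subgraph C B" "subgraph B H" "connected B" for B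
  proof -
    obtain x where x: "x \<in> verts C"
      using assms(2) by (auto simp: connected_def strongly_connected_def)
    moreover have "verts C \<subseteq> verts B" "arcs C \<subseteq> arcs B" using B(1) by auto
    ultimately show ?thesis
      using connected_subset_arc_closed[OF B(2,3) assms(3,1), of x]
      by (intro subgraph_antisym_sets[OF B(2) assms(1)]) auto
  qed
  then show ?thesis
    using assms by (auto simp: components_def pre_digraph.max_subgraph_def)
qed

text \<open>Adding an incident arc \<open>a\<close> to \<open>C\<close> keeps it connected, since
  every vertex is still joined to the end of \<open>a\<close> in \<open>C\<close>. Maximality then
  forces \<open>a\<close> to be in \<open>C\<close> already.\<close>

lemma components_arc_closed:
  assumes "C \<in> components H"
  shows "arc_closed H C"
  unfolding arc_closed_def
proof (intro ballI impI)
  fix a assume a: "a \<in> arcs H" "tail H a \<in> verts C \<or> head H a \<in> verts C"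
  have C: "subgraph C H" "connected C"
    and max: "\<And>B. \<lbrakk>subgraph C B; subgraph B H; connected B\<rbrakk> \<Longrightarrow> B = C"
    using assms by (auto simp: components_def pre_digraph.max_subgraph_def)
  interpret C: wf_digraph C using C by auto
  interpret H: wf_digraph H using C by auto
  have tl: "tail C = tail H" "head C = head H" using C by (auto simp: subgraph_def compatible_def)
  let ?B = "C.add_arc a"
  interpret B: wf_digraph ?B by (rule C.wf_digraph_add_arc)
  have sub: "subgraph C ?B" "subgraph ?B H"
    using C a(1) by (auto simp: subgraph_def compatible_def C.verts_add_arc_conv tl
        B.wf_digraph_axioms C.wf_digraph_axioms)
  let ?R = "(arcs_ends ?B \<union> (arcs_ends ?B)\<inverse>)\<^sup>*"
  have "sym ?R" by (intro sym_rtrancl sym_Un_converse)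
  obtain x where x: "x \<in> verts C" "x = tail H a \<or> x = head H a" using a(2) by auto
  have "arcs_ends C \<subseteq> arcs_ends ?B" by (rule arcs_ends_mono[OF sub(1)])
  then have mono: "(arcs_ends C \<union> (arcs_ends C)\<inverse>)\<^sup>* \<subseteq> ?R"
    by (intro rtrancl_mono) auto
  have edge: "(tail H a, head H a) \<in> ?R" "(head H a, tail H a) \<in> ?R"
    by (auto simp: arcs_ends_conv tl intro!: r_into_rtrancl)
  have x_to: "(x, y) \<in> ?R" if "y \<in> verts ?B" for y
  proof (cases "y \<in> verts C")
    case True
    then show ?thesis using C(2) x mono by (auto simp: C.connected_conv)
  next
    case False
    then show ?thesis using that x edge by (auto simp: C.verts_add_arc_conv tl)
  qed
  have "(y, z) \<in> ?R" if "y \<in> verts ?B" "z \<in> verts ?B" for y z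
    using x_to[OF that(1)] x_to[OF that(2)] \<open>sym ?R\<close> by (meson symE rtrancl_trans)
  then have "connected ?B"
    using x by (auto simp: B.connected_conv C.verts_add_arc_conv)
  then have "?B = C" using max sub by blast
  then have "arcs ?B = arcs C" by simp
  then show "a \<in> arcs C" by auto
qed

lemma components_eqI:
  assumes "B \<in> components H" "C \<in> components H" "x \<in> verts B" "x \<in> verts C"
  shows "B = C"
proof -
  have *: "subgraph B H" "connected B" "subgraph C H" "connected C"
    using assms by (auto simp: components_def pre_digraph.max_subgraph_def)
  note cl = components_arc_closed[OF assms(1)] components_arc_closed[OF assms(2)]
  show ?thesis
    using connected_subset_arc_closed[OF *(1,2) cl(2) *(3) assms(3,4)]
      connected_subset_arc_closed[OF *(3,4) cl(1) *(1) assms(4,3)]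
    by (intro subgraph_antisym_sets[OF *(1,3)]) auto
qed

section \<open>Digraphs with in- and out-degrees at most one\<close>

text \<open>When \<open>t\<close> and \<open>h\<close> are injective on a finite \<open>F\<close>,
  these are the nonempty unions of directed cycles. Tail and head are parameters because contraction
  changes them.\<close>

definition balanced :: "('b \<Rightarrow> 'a) \<Rightarrow> ('b \<Rightarrow> 'a) \<Rightarrow> 'b set \<Rightarrow> 'b set set" where
  "balanced t h F = {S. S \<subseteq> F \<and> S \<noteq> {} \<and> t ` S = h ` S}"

definition min_balanced :: "('b \<Rightarrow> 'a) \<Rightarrow> ('b \<Rightarrow> 'a) \<Rightarrow> 'b set \<Rightarrow> 'b set set" where
  "min_balanced t h F = {S \<in> balanced t h F. \<forall>T \<in> balanced t h F. T \<subseteq> S \<longrightarrow> T = S}"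

text \<open>Injectivity of \<open>tail\<close> and \<open>head\<close> on the arcs expresses
  out-degree and in-degree at most 1.\<close>

locale linear_digraph = fin_digraph +
  assumes inj_tail: "inj_on (tail G) (arcs G)"
    and inj_head: "inj_on (head G) (arcs G)"
begin

section \<open>Directed cycles as minimal balanced sets\<close>

lemma cycle_balanced:
  assumes "cycle p"
  shows "set p \<in> balanced (tail G) (head G) (arcs G)"
proof -
  obtain u where u: "awalk u p u" "p \<noteq> []" using assms by (auto simp: cycle_def)
  then have cas: "cas u p u" "set p \<subseteq> arcs G" by (auto simp: awalk_def)
  have "awalk_verts u p = map (tail G) p @ [u]"
    using u awalk_verts_conv[of u p] awlast_of_awalk[OF u(1)] by (metis awlast_if_cas cas(1) last_snoc)
  moreover have "awalk_verts u p = u # map (head G) p"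
    using u awalk_verts_conv'[OF cas(1)] cas by (simp add: cas_simp)
  \<comment> \<open>The vertex list of the closed walk is read in two ways, as tails followed by
    \<open>u\<close> and as \<open>u\<close> followed by heads. Passing to multisets lets
    \<open>u\<close> be cancelled.\<close>
  ultimately have "mset (map (tail G) p @ [u]) = mset (u # map (head G) p)" by simp
  then have "mset (map (tail G) p) = mset (map (head G) p)" by simp
  then have "set (map (tail G) p) = set (map (head G) p)" by (rule mset_eq_setD)
  then show ?thesis using u cas by (auto simp: balanced_def)
qed

text \<open>The tails of \<open>T\<close> are closed under following arcs: by injectivity the arc
  leaving such a vertex is in \<open>T\<close>, and its head is again a tail of \<open>T\<close>.
  All of the cycle is reachable from any one of its arcs, so \<open>T\<close> exhausts it.\<close>

lemma balanced_subset_cycle_eq: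
  assumes "cycle p" "T \<in> balanced (tail G) (head G) (arcs G)" "T \<subseteq> set p"
  shows "T = set p"
proof
  obtain u where u: "awalk u p u" using assms(1) by (auto simp: cycle_def)
  have p: "set p \<subseteq> arcs G" using u by auto
  have T: "tail G ` T = head G ` T" "T \<subseteq> arcs G" using assms(2) by (auto simp: balanced_def)
  obtain a where a: "a \<in> T" using assms(2) by (auto simp: balanced_def)
  have in_T: "b \<in> T" if "b \<in> arcs G" "tail G b \<in> tail G ` T" for b
    using that inj_tail T by (auto dest: inj_onD)
  have step: "z \<in> tail G ` T" if yz: "y \<rightarrow>\<^bsub>G\<^esub> z" and y: "y \<in> tail G ` T" for y z
  proof -
    obtain b where "b \<in> arcs G" "tail G b = y" "head G b = z" using yz by auto
    then have "z \<in> head G ` T" using in_T y by blast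
    then show ?thesis using T by simp
  qed
  have closed: "w \<in> tail G ` T" if "tail G a \<rightarrow>\<^sup>* w" for w
    using that by (induction rule: reachable_induct) (use a step in blast)+
  show "set p \<subseteq> T"
  proof
    fix b assume b: "b \<in> set p"
    have "tail G a \<rightarrow>\<^sup>* u"
      using a assms(3) by (intro awalk_verts_reachable_to[OF u] awalk_verts_arc1) auto
    also have "u \<rightarrow>\<^sup>* tail G b"
      using b by (intro awalk_verts_reachable_from[OF u] awalk_verts_arc1)
    finally show "b \<in> T" using closed in_T b p by blast
  qed
qed fact

text \<open>Every head of an arc in \<open>S\<close> is also the tail of an arc in \<open>S\<close>,
  so the digraph on \<open>S\<close> has no sink and, being finite, cannot be acyclic.\<close>

lemma balanced_contains_cycle:
  assumes "S \<in> balanced (tail G) (head G) (arcs G)"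
  shows "\<exists>p. cycle p \<and> set p \<subseteq> S"
proof -
  have S: "tail G ` S = head G ` S" "S \<subseteq> arcs G" "S \<noteq> {}" using assms by (auto simp: balanced_def)
  let ?K = "G\<lparr>verts := head G ` S, arcs := S\<rparr>"
  interpret K: wf_digraph ?K by unfold_locales (use S in auto)
  have "finite (arcs_ends ?K)" using S finite_subset[OF S(2)] by (simp add: arcs_ends_conv)
  have "\<not> acyclic (arcs_ends ?K)"
  proof
    assume "acyclic (arcs_ends ?K)"
    then have wf: "wf ((arcs_ends ?K)\<inverse>)"
      using \<open>finite (arcs_ends ?K)\<close> by (rule finite_acyclic_wf_converse[rotated])
    obtain x where x: "x \<in> head G ` S" using S by auto
    \<comment> \<open>Minimality in the converse relation makes \<open>y\<close> a sink, yet
      \<open>y\<close> is the tail of some arc of \<open>S\<close>.\<close>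
    obtain y where y: "y \<in> head G ` S" "\<And>z. (z, y) \<in> (arcs_ends ?K)\<inverse> \<Longrightarrow> z \<notin> head G ` S"
      using wfE_min[OF wf x] by metis
    then obtain a where "a \<in> S" "tail G a = y" using S(1) by (metis imageE)
    then have "(head G a, y) \<in> (arcs_ends ?K)\<inverse>" by (auto simp: arcs_ends_conv)
    then show False using y(2) \<open>a \<in> S\<close> by blast
  qed
  then obtain x where "x \<rightarrow>\<^sup>+\<^bsub>?K\<^esub> x" by (auto simp: acyclic_def)
  then obtain q where "K.closed_w q" by (auto simp: K.reachable1_awalk K.closed_w_def)
  then obtain p where p: "K.cycle p" using K.closed_w_imp_cycle by auto
  have "subgraph ?K G"
    using S by (auto simp: subgraph_def compatible_def K.wf_digraph_axioms wf_digraph_axioms)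
  then have "cycle p" using p by (rule subgraph_cycle)
  moreover have "set p \<subseteq> S" using p by (auto simp: K.cycle_def K.awalk_def)
  ultimately show ?thesis by auto
qed

lemma min_balanced_conv_cycle:
  "min_balanced (tail G) (head G) (arcs G) = {set p |p. cycle p}"
proof (intro equalityI subsetI)
  fix S assume "S \<in> min_balanced (tail G) (head G) (arcs G)"
  then have S: "S \<in> balanced (tail G) (head G) (arcs G)"
    "\<And>T. T \<in> balanced (tail G) (head G) (arcs G) \<Longrightarrow> T \<subseteq> S \<Longrightarrow> T = S"
    by (auto simp: min_balanced_def)
  obtain p where "cycle p" "set p \<subseteq> S" using balanced_contains_cycle[OF S(1)] by auto
  then have "set p = S" using S(2) cycle_balanced by blast
  then show "S \<in> {set p |p. cycle p}" using \<open>cycle p\<close> by blast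
next
  fix S assume "S \<in> {set p |p. cycle p}"
  then show "S \<in> min_balanced (tail G) (head G) (arcs G)"
    using cycle_balanced balanced_subset_cycle_eq unfolding min_balanced_def by blast
qed

text \<open>By injectivity, an arc that shares its tail or its head with an arc of the cycle is that
  arc. Hence the cycle is arc-closed, and connected as a walk.\<close>

lemma cycle_in_components:
  assumes "cycle p"
  shows "G\<lparr>verts := head G ` set p, arcs := set p\<rparr> \<in> components G" (is "?C \<in> _")
    and "is_dicycle (G\<lparr>verts := head G ` set p, arcs := set p\<rparr>)"
proof -
  obtain u where u: "awalk u p u" "distinct (tl (awalk_verts u p))" "p \<noteq> []"
    using assms by (auto simp: cycle_def)
  then have p: "set p \<subseteq> arcs G" by auto
  have eq: "tail G ` set p = head G ` set p"
    using cycle_balanced[OF assms] by (auto simp: balanced_def)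
  interpret C: wf_digraph ?C by unfold_locales (use eq in auto)
  have comp: "compatible ?C G" by (simp add: compatible_def)
  have sub: "subgraph ?C G"
    using p by (auto simp: subgraph_def compatible_def C.wf_digraph_axioms wf_digraph_axioms)
  have vs: "set (awalk_verts u p) = head G ` set p"
    using set_awalk_verts_not_Nil[OF u(1,3)] eq by auto
  have "u \<in> head G ` set p" using vs hd_in_awalk_verts[of u p u] u by auto
  then have w: "C.awalk u p u"
    using u by (auto simp: C.awalk_def awalk_def compatible_cas[OF comp])
  have "connected ?C"
    using C.awalk_imp_connected[OF w] vs by (simp add: compatible_awalk_verts[OF comp])
  moreover have "arc_closed G ?C"
  proof -
    have "a \<in> set p" if "a \<in> arcs G" "tail G a \<in> tail G ` set p \<or> head G a \<in> head G ` set p" for a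
      using that p inj_tail inj_head by (auto dest: inj_onD)
    then show ?thesis by (auto simp: arc_closed_def eq)
  qed
  ultimately show "?C \<in> components G" using sub by (intro arc_closed_in_components)
  show "is_dicycle ?C"
    unfolding is_dicycle_def C.cycle_def
    using w u by (auto simp: compatible_awalk_verts[OF comp])
qed

lemma kc_conv: "kc G = card (min_balanced (tail G) (head G) (arcs G))"
proof -
  let ?K = "{C \<in> components G. is_dicycle C}"
  have sub: "subgraph C G" if "C \<in> components G" for C
    using that by (auto simp: components_def max_subgraph_def)
  \<comment> \<open>A cyclic component is determined by its arcs, because its vertices are their
    heads.\<close>
  have "inj_on arcs ?K"
  proof (rule inj_onI)
    fix B C assume B: "B \<in> ?K" and C: "C \<in> ?K" and eq: "arcs B = arcs C"
    have "verts B = head G ` arcs B" "verts C = head G ` arcs C"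
      using B C sub[of B] sub[of C] by (auto simp: is_dicycle_def subgraph_def compatible_def)
    then show "B = C" using B C sub eq by (intro subgraph_antisym_sets[of B G C]) auto
  qed
  moreover have "arcs ` ?K = {set p |p. cycle p}"
  proof (intro equalityI subsetI)
    fix S assume "S \<in> arcs ` ?K"
    then show "S \<in> {set p |p. cycle p}"
      using sub by (auto simp: is_dicycle_def dest: subgraph_cycle)
  next
    fix S assume "S \<in> {set p |p. cycle p}"
    then obtain p where "S = set p" "cycle p" by auto
    then show "S \<in> arcs ` ?K"
      using cycle_in_components[of p]
      by (intro image_eqI[where x = "G\<lparr>verts := head G ` set p, arcs := set p\<rparr>"]) auto
  qed
  ultimately show ?thesis
    using card_image[of arcs ?K] by (simp add: kc_def min_balanced_conv_cycle)
qed

section \<open>Path components and their start vertices\<close>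

text \<open>A longest path from \<open>u\<close> is a whole component: nothing enters its start,
  nothing leaves its end, and elsewhere the degree bounds leave room only for its own arcs.\<close>

lemma source_dipath_component:
  assumes u: "u \<in> tail G ` arcs G - head G ` arcs G"
  shows "\<exists>C \<in> components G. is_nontrivial_dipath C \<and> u \<in> verts C"
proof -
  obtain a where a: "a \<in> arcs G" "tail G a = u" using u by auto
  \<comment> \<open>Since \<open>u\<close> is not a head, \<open>a\<close> is no loop and
    \<open>[a]\<close> is a path. This makes the longest path nonempty.\<close>
  have "head G a \<noteq> u" using a u by blast
  then have a_path: "apath u [a] (head G a)" using a by (auto simp: apath_simps)
  then have "\<exists>v. apath u [a] v" by blast
  moreover have "\<forall>q. (\<exists>v. apath u q v) \<longrightarrow> length q < card (verts G)"
    using length_apath_less by blast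
  ultimately have "\<exists>p. (\<exists>v. apath u p v) \<and> (\<forall>q. (\<exists>v. apath u q v) \<longrightarrow> length q \<le> length p)"
    by (rule ex_has_greatest_nat[where f = length and P = "\<lambda>p. \<exists>v. apath u p v"])
  then obtain p v where v: "apath u p v" and max: "\<And>q w. apath u q w \<Longrightarrow> length q \<le> length p"
    by metis
  have w: "awalk u p v" and dist: "distinct (awalk_verts u p)" using v by (auto simp: apath_def)
  have pa: "set p \<subseteq> arcs G" using w by auto
  have ne: "p \<noteq> []" using max[OF a_path] by auto
  have vt: "awalk_verts u p = map (tail G) p @ [v]"
  proof -
    have "awlast u p = v" using w by simp
    then show ?thesis using awalk_verts_conv[of u p] ne by simp
  qed
  have vh: "awalk_verts u p = u # map (head G) p"
    using awalk_verts_conv'[of u p v] ne w by (auto simp: awalk_def cas_simp)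
  \<comment> \<open>An arc leaving the end \<open>v\<close> would extend the path: its head is
    neither the source \<open>u\<close> nor, by injectivity of \<open>head\<close>, the head of a
    path arc. This contradicts the maximal length.\<close>
  have no_out: "tail G b \<noteq> v" if b: "b \<in> arcs G" for b
  proof
    assume bv: "tail G b = v"
    have "b \<notin> set p" using bv dist vt by auto
    have "head G b \<noteq> u" using u b by blast
    moreover have "head G b \<notin> head G ` set p"
      using \<open>b \<notin> set p\<close> pa b inj_head by (auto dest: inj_onD)
    ultimately have nin: "head G b \<notin> set (awalk_verts u p)" using vh by auto
    have l: "awlast u p = v" using w by simp
    have "v \<in> set (awalk_verts u p)" using vt by simp
    then have "head G b \<noteq> v" using nin by auto
    then have "apath u (p @ [b]) (head G b)"
      unfolding apath_append_iff l using v b bv nin by (auto simp: apath_simps)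
    then show False using max by fastforce
  qed
  let ?C = "G\<lparr>verts := set (awalk_verts u p), arcs := set p\<rparr>"
  interpret C: wf_digraph ?C
    by unfold_locales (use awalk_verts_arc1 awalk_verts_arc2[OF w] in auto)
  have comp: "compatible ?C G" by (simp add: compatible_def)
  have sub: "subgraph ?C G"
    using w by (auto simp: subgraph_def compatible_def C.wf_digraph_axioms wf_digraph_axioms)
  have uC: "u \<in> set (awalk_verts u p)" using vh by simp
  have Cw: "C.awalk u p v"
    using w uC by (auto simp: C.awalk_def awalk_def compatible_cas[OF comp])
  have "connected ?C"
    using C.awalk_imp_connected[OF Cw] by (simp add: compatible_awalk_verts[OF comp])
  moreover have "arc_closed G ?C"
    unfolding arc_closed_def
  proof (intro ballI impI)
    fix b assume b: "b \<in> arcs G" "tail G b \<in> verts ?C \<or> head G b \<in> verts ?C"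
    then have "tail G b \<in> tail G ` set p \<or> head G b \<in> head G ` set p"
    proof (elim disjE)
      assume "tail G b \<in> verts ?C"
      then show ?thesis using no_out[OF b(1)] by (auto simp: vt)
    next
      assume "head G b \<in> verts ?C"
      moreover have "head G b \<noteq> u" using u b(1) by blast
      ultimately show ?thesis by (auto simp: vh)
    qed
    then show "b \<in> arcs ?C"
      using b(1) pa inj_tail inj_head by (auto dest: inj_onD)
  qed
  ultimately have "?C \<in> components G" using sub by (intro arc_closed_in_components)
  moreover have "is_nontrivial_dipath ?C"
    unfolding is_nontrivial_dipath_def C.apath_def
    using Cw ne dist by (auto simp: compatible_awalk_verts[OF comp])
  ultimately show ?thesis using uC by (intro bexI[of _ ?C]) auto
qed

text \<open>An arc into the start vertex would by closure be an arc of the path, and the start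
  vertex would then be repeated. All other vertices of the path are heads.\<close>

lemma dipath_component_source:
  assumes C: "C \<in> components G" "is_nontrivial_dipath C"
  shows "\<exists>u. verts C \<inter> (tail G ` arcs G - head G ` arcs G) = {u}"
proof -
  have sub: "subgraph C G" using C by (auto simp: components_def max_subgraph_def)
  interpret C: wf_digraph C using sub by auto
  have tl: "tail C = tail G" "head C = head G" and ss: "arcs C \<subseteq> arcs G"
    using sub by (auto simp: subgraph_def compatible_def)
  obtain u p v where p: "C.apath u p v" "p \<noteq> []" "arcs C = set p"
    "verts C = set (C.awalk_verts u p)"
    using C(2) by (auto simp: is_nontrivial_dipath_def)
  then have w: "C.cas u p v" "distinct (C.awalk_verts u p)" by (auto simp: C.apath_def C.awalk_def)
  have vh: "C.awalk_verts u p = u # map (head G) p"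
    using C.awalk_verts_conv'[OF w(1)] p w by (auto simp: C.cas_simp tl)
  have "tail G (hd p) = u" using w p by (auto simp: C.cas_simp tl)
  moreover have "hd p \<in> arcs G" using p ss by auto
  ultimately have "u \<in> tail G ` arcs G" by auto
  moreover have "u \<notin> head G ` arcs G"
  proof
    assume "u \<in> head G ` arcs G"
    then obtain a where a: "a \<in> arcs G" "head G a = u" by auto
    have "u \<in> verts C" using p vh by auto
    then have "a \<in> arcs C" using components_arc_closed[OF C(1)] a by (auto simp: arc_closed_def)
    then have "u \<in> head G ` set p" using a p by auto
    then show False using w(2) vh by auto
  qed
  moreover have "verts C = insert u (head G ` set p)" using p vh by auto
  ultimately show ?thesis using ss p(3) by (intro exI[of _ u]) auto
qed

lemma kp_conv: "kp G = card (tail G ` arcs G - head G ` arcs G)"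
proof -
  let ?Q = "tail G ` arcs G - head G ` arcs G"
  let ?K = "{C \<in> components G. is_nontrivial_dipath C}"
  define src where "src C = the_elem (verts C \<inter> ?Q)" for C :: "('a, 'b) pre_digraph"
  have src: "verts C \<inter> ?Q = {src C}" if "C \<in> ?K" for C
  proof -
    obtain u where "verts C \<inter> ?Q = {u}" using dipath_component_source[of C] \<open>C \<in> ?K\<close> by blast
    then show ?thesis by (simp add: src_def)
  qed
  have "inj_on src ?K"
  proof (rule inj_onI)
    fix B C assume BC: "B \<in> ?K" "C \<in> ?K" "src B = src C"
    then have "src B \<in> verts B" "src B \<in> verts C" using src[of B] src[of C] by auto
    then show "B = C" using BC by (auto intro: components_eqI)
  qed
  moreover have "src ` ?K = ?Q"
  proof (intro equalityI subsetI)
    fix u assume "u \<in> src ` ?K"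
    then show "u \<in> ?Q" using src by blast
  next
    fix u assume u: "u \<in> ?Q"
    then obtain C where "C \<in> ?K" "u \<in> verts C" using source_dipath_component by blast
    then show "u \<in> src ` ?K" using src[of C] u by blast
  qed
  ultimately show ?thesis unfolding kp_def by (metis card_image)
qed

end

section \<open>The three arc operations\<close>

lemma card_le_1_iff_inj_on:
  assumes "finite F"
  shows "(\<forall>v. card {a \<in> F. f a = v} \<le> 1) \<longleftrightarrow> inj_on f F"
proof -
  have "card {a \<in> F. f a = v} \<le> 1 \<longleftrightarrow> (\<forall>a \<in> F. \<forall>b \<in> F. f a = v \<and> f b = v \<longrightarrow> a = b)" for v
    using assms card_le_Suc0_iff_eq[of "{a \<in> F. f a = v}"] by auto
  then show ?thesis by (simp only: inj_on_def) blast
qed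

lemma (in fin_digraph) cycle_path_sets_conv:
  "cycle_path_sets G = {F. F \<subseteq> arcs G \<and> inj_on (tail G) F \<and> inj_on (head G) F}"
proof -
  have "(\<forall>v \<in> verts G. in_degree (span_sub G F) v \<le> 1 \<and> out_degree (span_sub G F) v \<le> 1) \<longleftrightarrow>
      inj_on (tail G) F \<and> inj_on (head G) F" if F: "F \<subseteq> arcs G" for F
  proof -
    have "finite F" using F by (rule finite_subset) simp
    \<comment> \<open>Values outside \<open>verts G\<close> are neither heads nor tails, so the
      degree bounds may be quantified over the whole type.\<close>
    have "card {a \<in> F. head G a = v} \<le> 1" "card {a \<in> F. tail G a = v} \<le> 1" if "v \<notin> verts G" for v
    proof -
      have "{a \<in> F. head G a = v} = {}" "{a \<in> F. tail G a = v} = {}" using that F by auto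
      then show "card {a \<in> F. head G a = v} \<le> 1" "card {a \<in> F. tail G a = v} \<le> 1"
        by (simp_all only: card.empty zero_le)
    qed
    then have "(\<forall>v \<in> verts G. card {a \<in> F. head G a = v} \<le> 1 \<and> card {a \<in> F. tail G a = v} \<le> 1) \<longleftrightarrow>
        (\<forall>v. card {a \<in> F. head G a = v} \<le> 1) \<and> (\<forall>v. card {a \<in> F. tail G a = v} \<le> 1)"
      by blast
    then show ?thesis
      unfolding card_le_1_iff_inj_on[OF \<open>finite F\<close>]
      by (auto simp: in_degree_def out_degree_def in_arcs_def out_arcs_def span_sub_def)
  qed
  then show ?thesis by (auto simp: cycle_path_sets_def)
qed

lemma (in fin_digraph) finite_cycle_path_sets: "finite (cycle_path_sets G)"
  by (rule finite_subset[of _ "Pow (arcs G)"]) (auto simp: cycle_path_sets_def)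

lemma (in fin_digraph) kc_kp_span_sub:
  assumes "F \<in> cycle_path_sets G"
  shows "kc (span_sub G F) = card (min_balanced (tail G) (head G) F)"
    and "kp (span_sub G F) = card (tail G ` F - head G ` F)"
proof -
  have F: "F \<subseteq> arcs G" "inj_on (tail G) F" "inj_on (head G) F"
    using assms by (auto simp: cycle_path_sets_conv)
  interpret H: linear_digraph "span_sub G F"
    by unfold_locales
      (use F finite_subset[OF F(1)] in \<open>auto simp: span_sub_def subset_eq\<close>)
  show "kc (span_sub G F) = card (min_balanced (tail G) (head G) F)"
    and "kp (span_sub G F) = card (tail G ` F - head G ` F)"
    using H.kc_conv H.kp_conv by (simp_all add: span_sub_def)
qed

text \<open>The summand of the polynomial as a function of the two maps, so that summands of the
  original and of the contracted digraph can be compared on the same arc set.\<close>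

definition weight :: "'r::comm_ring_1 \<Rightarrow> 'r \<Rightarrow> 'r \<Rightarrow> ('b \<Rightarrow> 'a) \<Rightarrow> ('b \<Rightarrow> 'a) \<Rightarrow> 'b set \<Rightarrow> 'r" where
  "weight x y z t h F = x ^ card F * y ^ card (min_balanced t h F) * z ^ card (t ` F - h ` F)"

lemma (in fin_digraph) cycle_path_poly_conv:
  "cycle_path_poly G x y z = (\<Sum>F \<in> cycle_path_sets G. weight x y z (tail G) (head G) F)"
  unfolding cycle_path_poly_def weight_def by (intro sum.cong) (simp_all add: kc_kp_span_sub)

lemma balanced_cong:
  assumes "\<And>a. a \<in> F \<Longrightarrow> t a = t' a" "\<And>a. a \<in> F \<Longrightarrow> h a = h' a"
  shows "balanced t h F = balanced t' h' F"
proof -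
  have "t ` S = h ` S \<longleftrightarrow> t' ` S = h' ` S" if "S \<subseteq> F" for S
  proof -
    have "t ` S = t' ` S" "h ` S = h' ` S" using that assms by (auto intro!: image_cong)
    then show ?thesis by simp
  qed
  then show ?thesis unfolding balanced_def by (simp only: cong: conj_cong)
qed

lemma weight_cong:
  assumes "\<And>a. a \<in> F \<Longrightarrow> t a = t' a" "\<And>a. a \<in> F \<Longrightarrow> h a = h' a"
  shows "weight x y z t h F = weight x y z t' h' F"
proof -
  have "balanced t h F = balanced t' h' F" using assms by (rule balanced_cong)
  moreover have "t ` F = t' ` F" "h ` F = h' ` F" using assms by (auto intro!: image_cong)
  ultimately show ?thesis by (simp add: weight_def min_balanced_def)
qed

section \<open>The effect of inserting \<open>e\<close> on the weight\<close>

lemma card_min_balanced_order_iso: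
  assumes bij: "bij_betw f (balanced t h F) (balanced t' h' F')"
    and mono: "\<And>S T. \<lbrakk>S \<in> balanced t h F; T \<in> balanced t h F\<rbrakk> \<Longrightarrow> f S \<subseteq> f T \<longleftrightarrow> S \<subseteq> T"
  shows "card (min_balanced t h F) = card (min_balanced t' h' F')"
proof -
  have inj: "inj_on f (balanced t h F)" and im: "f ` balanced t h F = balanced t' h' F'"
    using bij by (auto simp: bij_betw_def)
  have "f ` min_balanced t h F = min_balanced t' h' F'"
    unfolding min_balanced_def im[symmetric] using mono inj
    by (auto simp: inj_on_eq_iff)
  moreover have "inj_on f (min_balanced t h F)"
    by (rule inj_on_subset[OF inj]) (auto simp: min_balanced_def)
  ultimately show ?thesis by (metis card_image)
qed

text \<open>Since \<open>{e}\<close> is balanced, it is the only minimal balanced set containing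
  \<open>e\<close>, which gives the extra factor \<open>y\<close>. The vertex \<open>u\<close>
  becomes both a tail and a head, so the start vertices stay the same.\<close>

lemma weight_insert_loop:
  assumes "finite F" "e \<notin> F" "t e = u" "h e = u" "u \<notin> t ` F" "u \<notin> h ` F"
  shows "weight x y z t h (insert e F) = x * y * weight x y z t h F"
proof -
  have e: "{e} \<in> balanced t h (insert e F)" using assms by (auto simp: balanced_def)
  have sub: "S \<in> balanced t h (insert e F) \<longleftrightarrow> S \<in> balanced t h F" if "e \<notin> S" for S
    using that by (auto simp: balanced_def)
  have "min_balanced t h (insert e F) = insert {e} (min_balanced t h F)"
  proof (intro equalityI subsetI)
    fix S assume S: "S \<in> min_balanced t h (insert e F)"
    show "S \<in> insert {e} (min_balanced t h F)"
    proof (cases "e \<in> S")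
      case True
      then have "{e} = S" using S e by (simp add: min_balanced_def)
      then show ?thesis by simp
    next
      case False
      then show ?thesis using S sub unfolding min_balanced_def by blast
    qed
  next
    fix S assume "S \<in> insert {e} (min_balanced t h F)"
    then consider "S = {e}" | "S \<in> min_balanced t h F" by blast
    then show "S \<in> min_balanced t h (insert e F)"
    proof cases
      case 1
      then show ?thesis using e by (auto simp: min_balanced_def balanced_def)
    next
      case 2
      then have "e \<notin> S" using assms(2) by (auto simp: min_balanced_def balanced_def)
      then show ?thesis using 2 sub unfolding min_balanced_def by blast
    qed
  qed
  moreover have "{e} \<notin> min_balanced t h F"
    using assms(2) by (auto simp: min_balanced_def balanced_def)
  moreover have "finite (min_balanced t h F)"
    by (rule finite_subset[of _ "Pow F"]) (use assms(1) in \<open>auto simp: min_balanced_def balanced_def\<close>)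
  ultimately have "card (min_balanced t h (insert e F)) = Suc (card (min_balanced t h F))"
    by simp
  moreover have "t ` insert e F - h ` insert e F = t ` F - h ` F"
    using assms by auto
  ultimately show ?thesis using assms by (simp add: weight_def)
qed

text \<open>Removing \<open>e\<close> is an order isomorphism of balanced sets. Only tails need
  redirecting, because no arc of \<open>F\<close> has head \<open>v\<close>.\<close>

lemma card_min_balanced_contract:
  assumes "t e = u" "h e = v" "u \<noteq> v" "e \<notin> F" "u \<notin> t ` F" "v \<notin> h ` F"
    and t': "t' = (\<lambda>a. if t a = v then u else t a)"
  shows "card (min_balanced t h (insert e F)) =
    card (min_balanced t' h F)"
proof (rule card_min_balanced_order_iso)
  let ?B = "balanced t h (insert e F)"
  have t_img: "t' ` S = (if v \<in> t ` S then insert u (t ` S - {v}) else t ` S)" for S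
    by (auto simp: t')
  have split: "t ` S = insert u (t ` (S - {e}))" "h ` S = insert v (h ` (S - {e}))" if "e \<in> S" for S
    using that assms by auto
  have u: "u \<notin> t ` (S - {e})" "v \<notin> h ` (S - {e})" if "S \<subseteq> insert e F" for S
    using that assms by auto
  have to: "S - {e} \<in> balanced t' h F" if "S \<in> ?B" for S
  proof -
    have S: "S \<subseteq> insert e F" "S \<noteq> {}" "t ` S = h ` S" using that by (auto simp: balanced_def)
    show ?thesis
    proof (cases "e \<in> S")
      case True
      have eq: "insert u (t ` (S - {e})) = insert v (h ` (S - {e}))"
        using S(3) split[OF True] by simp
      then have "v \<in> t ` (S - {e})" "u \<in> h ` (S - {e})"
        using assms(3) by (metis insert_iff)+
      moreover have "insert u (t ` (S - {e}) - {v}) = h ` (S - {e})"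
        using eq calculation u[OF S(1)] assms(3) by blast
      ultimately have "t' ` (S - {e}) = h ` (S - {e})" "S - {e} \<noteq> {}" by (auto simp: t_img)
      then show ?thesis using S(1) by (auto simp: balanced_def)
    next
      case False
      then have "v \<notin> t ` S" using S u[OF S(1)] by simp
      then show ?thesis using False S unfolding balanced_def t_img by auto
    qed
  qed
  show mono: "S - {e} \<subseteq> T - {e} \<longleftrightarrow> S \<subseteq> T" if ST: "S \<in> ?B" "T \<in> ?B" for S T
  proof
    assume sub: "S - {e} \<subseteq> T - {e}"
    \<comment> \<open>Since \<open>e\<close> leaves \<open>u\<close>, balance of \<open>S\<close>
      provides an arc of \<open>S\<close> into \<open>u\<close>. It also lies in \<open>T\<close>,
      so \<open>T\<close> must contain an arc leaving \<open>u\<close>, and \<open>e\<close> is the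
      only candidate.\<close>
    have "e \<in> T" if "e \<in> S"
    proof -
      have "u \<in> h ` (S - {e})" using ST(1) split[OF that] assms(3) by (auto simp: balanced_def)
      then have "u \<in> h ` T" using sub by auto
      moreover have T: "T \<subseteq> insert e F" "t ` T = h ` T" using ST(2) by (simp_all add: balanced_def)
      ultimately obtain a where "a \<in> T" "t a = u" by (metis imageE)
      then show ?thesis using assms(5) T(1) by auto
    qed
    then show "S \<subseteq> T" using sub by blast
  qed blast
  have "inj_on (\<lambda>S. S - {e}) ?B" by (intro inj_onI) (use mono in blast)
  moreover have "(\<lambda>S. S - {e}) ` ?B = balanced t' h F"
  proof (intro equalityI subsetI)
    fix S assume S: "S \<in> balanced t' h F"
    then have e: "e \<notin> S" and SF: "S \<subseteq> F" "S \<noteq> {}" "t' ` S = h ` S"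
      using assms(4) by (auto simp: balanced_def)
    show "S \<in> (\<lambda>S. S - {e}) ` ?B"
    \<comment> \<open>The preimage contains \<open>e\<close> exactly when \<open>S\<close> has an
      arc leaving \<open>v\<close>, which then needs an arc entering \<open>v\<close>.\<close>
    proof (cases "v \<in> t ` S")
      case True
      have "insert u (t ` S - {v}) = h ` S" using SF(3) True unfolding t_img by simp
      then have "insert u (t ` S) = insert v (h ` S)" using True by blast
      then have "insert e S \<in> ?B" using SF assms(1,2) by (auto simp: balanced_def)
      then show ?thesis using e by (intro image_eqI[of _ _ "insert e S"]) auto
    next
      case False
      then have "S \<in> ?B" using SF unfolding t_img balanced_def by auto
      then show ?thesis using e by (intro image_eqI[of _ _ S]) auto
    qed
  qed (use to in auto)
  ultimately show "bij_betw (\<lambda>S. S - {e}) ?B (balanced t' h F)" by (simp add: bij_betw_def)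
qed

text \<open>If no arc of \<open>F\<close> leaves \<open>v\<close> or enters \<open>u\<close>, then
  \<open>e\<close> alone forms a path component that contraction turns into an isolated vertex; this
  is the factor \<open>z\<close>. Otherwise the start vertices agree.\<close>

lemma weight_insert_contract:
  assumes "finite F" "t e = u" "h e = v" "u \<noteq> v" "e \<notin> F" "u \<notin> t ` F" "v \<notin> h ` F"
    and t': "t' = (\<lambda>a. if t a = v then u else t a)"
  shows "weight x y z t h (insert e F) =
    x * weight x y z t' h F * (if v \<notin> t ` F \<and> u \<notin> h ` F then z else 1)"
proof -
  have t_img: "t' ` F = (if v \<in> t ` F then insert u (t ` F - {v}) else t ` F)"
    by (auto simp: t')
  have "t ` insert e F - h ` insert e F = insert u (t ` F) - insert v (h ` F)" using assms by simp
  also have "\<dots> = (if v \<notin> t ` F \<and> u \<notin> h ` F then insert u (t' ` F - h ` F) else t' ` F - h ` F)"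
    unfolding t_img using assms by auto
  finally have "card (t ` insert e F - h ` insert e F) =
      card (t' ` F - h ` F) + (if v \<notin> t ` F \<and> u \<notin> h ` F then 1 else 0)"
    using assms(1,6) unfolding t_img by (simp add: card_insert_if)
  then show ?thesis
    unfolding weight_def card_min_balanced_contract[OF assms(2-8)] using assms(1,5) by simp
qed

section \<open>The recursion for the polynomial\<close>

lemma (in fin_digraph) fin_digraph_contract_arc:
  assumes "e \<in> arcs G"
  shows "fin_digraph (contract_arc G e)"
proof (cases "tail G e = head G e")
  case True
  then show ?thesis by (simp add: contract_arc_def fin_digraph_del_vert)
next
  case False
  then show ?thesis
    by unfold_locales (use tail_in_verts[OF assms] in \<open>auto simp: contract_arc_def Let_def\<close>)
qed

lemma (in fin_digraph) cycle_path_poly_del_arc: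
  assumes "e \<in> arcs G"
  shows "cycle_path_poly G x y z = cycle_path_poly (del_arc e) x y z +
    (\<Sum>F | e \<notin> F \<and> insert e F \<in> cycle_path_sets G. weight x y z (tail G) (head G) (insert e F))"
proof -
  let ?w = "weight x y z (tail G) (head G)"
  interpret D: fin_digraph "del_arc e" by (rule fin_digraph_del_arc)
  let ?A = "{F \<in> cycle_path_sets G. e \<notin> F}" and ?B = "{F \<in> cycle_path_sets G. e \<in> F}"
  have "cycle_path_sets (del_arc e) = ?A"
    by (auto simp: cycle_path_sets_conv D.cycle_path_sets_conv)
  then have "cycle_path_poly (del_arc e) x y z = sum ?w ?A"
    by (simp add: D.cycle_path_poly_conv)
  moreover have "sum ?w (cycle_path_sets G) = sum ?w ?A + sum ?w ?B"
    by (subst sum.union_disjoint[symmetric])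
      (use finite_cycle_path_sets in \<open>auto intro: arg_cong[of _ _ "sum ?w"]\<close>)
  moreover have "sum ?w ?B = (\<Sum>F | e \<notin> F \<and> insert e F \<in> cycle_path_sets G. ?w (insert e F))"
    by (rule sum.reindex_bij_witness[of _ "insert e" "\<lambda>F. F - {e}"]) (auto simp: insert_absorb)
  ultimately show ?thesis by (simp add: cycle_path_poly_conv)
qed

lemma (in fin_digraph) cycle_path_poly_loop:
  assumes e: "e \<in> arcs G" "tail G e = head G e"
  shows "cycle_path_poly G x y z =
    cycle_path_poly (del_arc e) x y z + x * y * cycle_path_poly (contract_arc G e) x y z"
proof -
  let ?C = "contract_arc G e"
  interpret C: fin_digraph ?C by (rule fin_digraph_contract_arc[OF e(1)])
  have C: "tail ?C = tail G" "head ?C = head G"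
    "arcs ?C = {a \<in> arcs G. tail G a \<noteq> tail G e \<and> head G a \<noteq> tail G e}"
    using e(2) by (simp_all add: contract_arc_def del_vert_simps)
  \<comment> \<open>Avoiding the tail and the head of \<open>e\<close> is what keeps both maps
    injective when \<open>e\<close> is inserted.\<close>
  have "F \<subseteq> arcs ?C \<longleftrightarrow> F \<subseteq> arcs G \<and> tail G e \<notin> tail G ` F \<and> head G e \<notin> head G ` F" for F
    unfolding C image_iff subset_iff mem_Collect_eq using e(2) by metis
  then have "{F. e \<notin> F \<and> insert e F \<in> cycle_path_sets G} = cycle_path_sets ?C"
    unfolding cycle_path_sets_conv C.cycle_path_sets_conv C(1,2) using e
    by (auto simp: inj_on_insert)
  moreover have "weight x y z (tail G) (head G) (insert e F) =
      x * y * weight x y z (tail G) (head G) F" if F: "F \<in> cycle_path_sets ?C" for F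
  proof (rule weight_insert_loop)
    have sub: "F \<subseteq> arcs ?C" using F by (simp add: cycle_path_sets_def)
    then show "finite F" using C.finite_arcs by (rule finite_subset)
    show "e \<notin> F" "tail G e \<notin> tail G ` F" "tail G e \<notin> head G ` F"
      using sub unfolding C by force+
  qed (use e in auto)
  ultimately show ?thesis
    unfolding cycle_path_poly_del_arc[OF e(1)] C.cycle_path_poly_conv C
    by (simp add: sum_distrib_left)
qed

lemma (in fin_digraph) cycle_path_poly_nonloop:
  assumes e: "e \<in> arcs G" "tail G e \<noteq> head G e"
  shows "cycle_path_poly G x y z = cycle_path_poly (del_arc e) x y z
    + x * cycle_path_poly (contract_arc G e) x y z
    + x * (z - 1) * cycle_path_poly (extract_arc G e) x y z"
proof -
  let ?C = "contract_arc G e" and ?X = "extract_arc G e"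
  let ?u = "tail G e" and ?v = "head G e"
  let ?t = "\<lambda>a. if tail G a = ?v then ?u else tail G a"
  let ?w = "weight x y z ?t (head G)"
  let ?isolated = "\<lambda>F. ?v \<notin> tail G ` F \<and> ?u \<notin> head G ` F"
  interpret C: fin_digraph ?C by (rule fin_digraph_contract_arc[OF e(1)])
  interpret X: fin_digraph ?X
    unfolding extract_arc_def by (rule fin_digraph.fin_digraph_del_vert[OF fin_digraph_del_vert])
  have C: "tail ?C = ?t" "head ?C = (\<lambda>a. if head G a = ?v then ?u else head G a)"
    "arcs ?C = {a \<in> arcs G. tail G a \<noteq> ?u \<and> head G a \<noteq> ?v}"
    using e(2) by (simp_all add: contract_arc_def Let_def)
  have X: "tail ?X = tail G" "head ?X = head G"
    "arcs ?X = {a \<in> arcs G. tail G a \<notin> {?u, ?v} \<and> head G a \<notin> {?u, ?v}}"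
    by (auto simp: extract_arc_def pre_digraph.del_vert_simps)
  \<comment> \<open>On arcs of the contraction, no original tail is \<open>u\<close> and no original
    head is \<open>v\<close>. The identification therefore merges no two tails and no two
    heads.\<close>
  have inC: "F \<in> cycle_path_sets ?C \<longleftrightarrow>
      F \<subseteq> arcs ?C \<and> inj_on (tail G) F \<and> inj_on (head G) F" for F
  proof -
    have "inj_on ?t F \<longleftrightarrow> inj_on (tail G) F" "inj_on (head ?C) F \<longleftrightarrow> inj_on (head G) F"
      if "F \<subseteq> arcs ?C"
    proof -
      have "?t a = ?t b \<longleftrightarrow> tail G a = tail G b" "head ?C a = head ?C b \<longleftrightarrow> head G a = head G b"
        if "a \<in> F" "b \<in> F" for a b
        using that \<open>F \<subseteq> arcs ?C\<close> unfolding C by auto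
      then show "inj_on ?t F \<longleftrightarrow> inj_on (tail G) F" "inj_on (head ?C) F \<longleftrightarrow> inj_on (head G) F"
        by (simp_all only: inj_on_def cong: ball_cong)
    qed
    then show ?thesis by (auto simp: C.cycle_path_sets_conv C(1))
  qed
  have "F \<subseteq> arcs ?C \<longleftrightarrow> F \<subseteq> arcs G \<and> ?u \<notin> tail G ` F \<and> ?v \<notin> head G ` F" for F
    unfolding C image_iff subset_iff mem_Collect_eq by metis
  then have sets: "{F. e \<notin> F \<and> insert e F \<in> cycle_path_sets G} = cycle_path_sets ?C"
    unfolding set_eq_iff inC cycle_path_sets_conv using e
    by (auto simp: inj_on_insert)
  \<comment> \<open>The sets that leave the merged vertex isolated use no arc at \<open>u\<close> or
    \<open>v\<close>, so they are the admissible sets of the extraction.\<close>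
  have isolated: "{F \<in> cycle_path_sets ?C. ?isolated F} = cycle_path_sets ?X"
  proof -
    have "F \<subseteq> arcs ?X \<longleftrightarrow> F \<subseteq> arcs ?C \<and> ?isolated F" for F
      unfolding C X image_iff subset_iff mem_Collect_eq insert_iff empty_iff by metis
    then show ?thesis
      unfolding set_eq_iff X.cycle_path_sets_conv mem_Collect_eq inC X(1,2) by blast
  qed
  \<comment> \<open>Writing the factor \<open>z\<close> as \<open>1 + (z - 1)\<close> separates a
    term for every \<open>F\<close> from a correction for the isolated case.\<close>
  have "weight x y z (tail G) (head G) (insert e F) =
      x * ?w F + x * (z - 1) * (if ?isolated F then ?w F else 0)" if "F \<in> cycle_path_sets ?C" for F
  proof -
    have sub: "F \<subseteq> arcs ?C" using that by (simp add: cycle_path_sets_def)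
    then have "finite F" using C.finite_arcs by (rule finite_subset)
    moreover have "e \<notin> F" "?u \<notin> tail G ` F" "?v \<notin> head G ` F"
      using sub unfolding C by force+
    ultimately show ?thesis
      using e(2) weight_insert_contract[of F "tail G" e ?u "head G" ?v ?t x y z]
      by (simp add: algebra_simps)
  qed
  then have "(\<Sum>F \<in> cycle_path_sets ?C. weight x y z (tail G) (head G) (insert e F)) =
      x * sum ?w (cycle_path_sets ?C) + x * (z - 1) * sum ?w (cycle_path_sets ?X)"
    using C.finite_cycle_path_sets
    by (simp add: sum.distrib sum_distrib_left sum.inter_filter isolated[symmetric])
  \<comment> \<open>The contraction also renames heads, but this changes nothing on its arcs, none
    of which has head \<open>v\<close>. Likewise, redirecting tails has no effect on the arcs of the
    extraction.\<close>
  moreover have "cycle_path_poly ?C x y z = sum ?w (cycle_path_sets ?C)"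
    unfolding C.cycle_path_poly_conv
    by (intro sum.cong weight_cong) (auto simp: inC C)
  moreover have "cycle_path_poly ?X x y z = sum ?w (cycle_path_sets ?X)"
    unfolding X.cycle_path_poly_conv
    by (intro sum.cong weight_cong) (auto simp: X.cycle_path_sets_conv X)
  ultimately show ?thesis
    unfolding cycle_path_poly_del_arc[OF e(1)] sets by simp
qed

lemma cycle_path_poly_arcless:
  assumes "fin_digraph E" "arcs E = {}"
  shows "cycle_path_poly E x y z = 1"
proof -
  interpret fin_digraph E by fact
  have "cycle_path_sets E = {{}}" using assms(2) by (auto simp: cycle_path_sets_conv)
  moreover have "min_balanced t h {} = {}" for t h :: "'b \<Rightarrow> 'a"
    by (auto simp: min_balanced_def balanced_def)
  ultimately show ?thesis by (simp add: cycle_path_poly_conv weight_def)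
qed

theorem theorem3p2:
  fixes x y z :: "'r::comm_ring_1"
  shows "(\<forall>(D :: ('a, 'b) pre_digraph) e. fin_digraph D \<and> e \<in> arcs D \<longrightarrow>
      cycle_path_poly D x y z =
        (if tail D e = head D e then
           cycle_path_poly (pre_digraph.del_arc D e) x y z
             + x * y * cycle_path_poly (contract_arc D e) x y z
         else
           cycle_path_poly (pre_digraph.del_arc D e) x y z
             + x * cycle_path_poly (contract_arc D e) x y z
             + x * (z - 1) * cycle_path_poly (extract_arc D e) x y z))
    \<and> (\<forall>n (E :: ('c, 'd) pre_digraph). arcless_digraph n E \<longrightarrow> cycle_path_poly E x y z = 1)"
  using fin_digraph.cycle_path_poly_loop fin_digraph.cycle_path_poly_nonloop cycle_path_poly_arcless
  by (auto simp: arcless_digraph_def)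

end
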